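(* Let $H$ be a Hopf algebra with bijective antipode over a field $k$, let $A$ be a principal right $H$-comodule algebra with $B=A^{\mathrm{co}(H)}$, let $I_H\subseteq H^+=\ker\varepsilon$ be a fixed right ideal of $H$, and let $$\Omega^1(A)=\Omega^1_{\mathrm u}(A)/N_A$$ be a right $H$-covariant first-order differential calculus on $A$ which is $\sigma$-generated with respect to $I_H$, with $\omega:H^+\to\Omega^1_{\mathrm u}(A)$ the connection 1-form (of a strong connection) appearing in the definition of $\sigma$-generated. Then $\omega$ descends to a well-defined map $$\bar\omega:H^+/I_H\longrightarrow\Omega^1(A),$$ that is, $\bar\omega(q_{I_H}(x))=q_{N_A}(\omega(x))$ for $x\in H^+$, where $q_{I_H}:H^+\to H^+/I_H$ and $q_{N_A}:\Omega^1_{\mathrm u}(A)\to\Omega^1(A)$ are the canonical quotient maps.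
   Context: All spaces are over a field $k$; algebras are associative and unital; $H$ is a Hopf algebra with coproduct $\Delta$, counit $\varepsilon$, bijective antipode $S$; $H^+=\ker\varepsilon$ and $h^+:=h-\varepsilon(h)1_H$. Sweedler notation is used. $\mathrm{Ad}_R(h)=h_{(2)}\otimes S(h_{(1)})h_{(3)}$ is the right adjoint coaction. Hopf--Galois extension: $A$ is a right $H$-comodule algebra with coaction $\delta(a)=a_{(0)}\otimes a_{(1)}$, $B=A^{\mathrm{co}(H)}=\{b\in A:\delta(b)=b\otimes 1\}$, and $B\subset A$ is Hopf--Galois if $\mathrm{can}:A\otimes_BA\to A\otimes H$, $\mathrm{can}(a\otimes_Ba')=aa'_{(0)}\otimes a'_{(1)}$, is bijective. Translation map: $\tau(h)=\mathrm{can}^{-1}(1\otimes h)=h^{\langle1\rangle}\otimes_Bh^{\langle2\rangle}$. $A$ is principal if $B\subset A$ is Hopf--Galois and the multiplication $B\otimes A\to A$ has a left $B$-linear, right $H$-colinear splitting. Universal calculus: $\Omega^1_{\mathrm u}(A)=\ker(m:A\otimes A\to A)$, $\mathrm d_{\mathrm u}(a)=1\otimes a-a\otimes 1$. A first-order differential calculus is a quotient $\Omega^1_{\mathrm u}(A)/N_A$ by an $A$-subbimodule $N_A$. $\Omega^1_{\mathrm u}(A)$ carries the diagonal right $H$-coaction $a\otimes a'\mapsto a_{(0)}\otimes a'_{(0)}\otimes a_{(1)}a'_{(1)}$; $N_A$ (and the calculus) is right $H$-covariant if $N_A$ is a right $H$-subcomodule. $\pi:A\otimes A\to A\otimes_BA$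 is the canonical quotient map. Durdević braiding: $\sigma:A\otimes_BA\to A\otimes_BA$, $\sigma(a\otimes_Ba')=a_{(0)}a'(a_{(1)})^{\langle1\rangle}\otimes_B(a_{(1)})^{\langle2\rangle}$ (a bijection). A subspace $V$ is $\sigma$-stable if $\sigma(V)=V$; $\langle W\rangle_\sigma$ is the smallest $\sigma$-stable subspace of $A\otimes_BA$ containing $W$. Strong connection: a linear map $\ell:H\to A\otimes A$ with $\ell(1_H)=1\otimes1$, $(\mathrm{id}\otimes\delta)\circ\ell=(\ell\otimes\mathrm{id})\circ\Delta$, and $\widetilde{\mathrm{can}}\circ\ell=1_A\otimes\mathrm{id}_H$ where $\widetilde{\mathrm{can}}(a\otimes a')=aa'_{(0)}\otimes a'_{(1)}$. Associated connection 1-form: $\omega:H^+\to\Omega^1_{\mathrm u}(A)$, $\omega(h^+)=\ell(h)-\varepsilon(h)1\otimes1$; the definition of connection 1-form includes the properties $\mathrm{ver}_{\mathrm u}\circ\omega=1_A\otimes\mathrm{id}_{H^+}$, where $\mathrm{ver}_{\mathrm u}(a\otimes a')=aa'_{(0)}\otimes(a'_{(1)})^+$, and $\delta_{\Omega^1_{\mathrm u}(A)}\circ\omega=(\omega\otimes\mathrm{id}_H)\circ\mathrm{Ad}_R$. $\sigma$-generated: a right $H$-covariant calculus $\Omega^1_{\mathrm u}(A)/N_A$ with $\ker\pi\subset N_A$ is $\sigma$-generated with respect to $I_H$ if there is a strong connection $\ell$ with connection 1-form $\omega$ such that $\pi(N_A)=A\cdot\langle\pi(\omega(I_H))\rangle_\sigma\cdot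 A$ (the $A$-subbimodule of $A\otimes_BA$ generated by $\langle\pi(\omega(I_H))\rangle_\sigma$). *)

theory Defs
  imports "HOL-Algebra.Module" "HOL-Algebra.QuotRing"
begin

section \<open>Linear algebra over a field \<open>K\<close>\<close>

definition linear_maps ::
  "('k, 'c) ring_scheme \<Rightarrow> ('k, 'v, 'd) module_scheme \<Rightarrow> ('k, 'w, 'e) module_scheme \<Rightarrow> ('v \<Rightarrow> 'w) set"
  where "linear_maps K V W = {f \<in> carrier V \<rightarrow> carrier W.
    (\<forall>x\<in>carrier V. \<forall>y\<in>carrier V. f (x \<oplus>\<^bsub>V\<^esub> y) = f x \<oplus>\<^bsub>W\<^esub> f y) \<and>
    (\<forall>c\<in>carrier K. \<forall>x\<in>carrier V. f (c \<odot>\<^bsub>V\<^esub> x) = c \<odot>\<^bsub>W\<^esub> f x)}"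

definition lin_span ::
  "('k, 'c) ring_scheme \<Rightarrow> ('k, 'v, 'd) module_scheme \<Rightarrow> 'v set \<Rightarrow> 'v set"
  where "lin_span K V X = \<Inter>{N. submodule N K V \<and> X \<subseteq> N}"

text \<open>The quotient of a module by a submodule \<open>N\<close>; its elements are the cosets of \<open>N\<close>, so the
  canonical map is \<open>x \<mapsto> N +> x\<close>.\<close>

definition quot_module :: "('k, 'v, 'd) module_scheme \<Rightarrow> 'v set \<Rightarrow> ('k, 'v set) module"
  where "quot_module V N =
    \<lparr>carrier = a_rcosets\<^bsub>V\<^esub> N, mult = rcoset_mult V N, one = N +>\<^bsub>V\<^esub> \<one>\<^bsub>V\<^esub>,
     zero = N, add = set_add V, smult = (\<lambda>c X. \<Union>x\<in>X. N +>\<^bsub>V\<^esub> (c \<odot>\<^bsub>V\<^esub> x))\<rparr>"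

text \<open>The map on cosets induced by a map that is constant on each of them.\<close>

definition descend :: "('v \<Rightarrow> 'w) \<Rightarrow> 'v set \<Rightarrow> 'w"
  where "descend f X = the_elem (f ` X)"

text \<open>Associative unital algebras that need not be commutative (unlike \<^locale>\<open>algebra\<close>).\<close>

definition assoc_algebra :: "('k, 'c) ring_scheme \<Rightarrow> ('k, 'a, 'd) module_scheme \<Rightarrow> bool"
  where "assoc_algebra K A \<longleftrightarrow> module K A \<and> ring A \<and>
    (\<forall>c\<in>carrier K. \<forall>a\<in>carrier A. \<forall>b\<in>carrier A.
       (c \<odot>\<^bsub>A\<^esub> a) \<otimes>\<^bsub>A\<^esub> b = c \<odot>\<^bsub>A\<^esub> (a \<otimes>\<^bsub>A\<^esub> b) \<and>
       a \<otimes>\<^bsub>A\<^esub> (c \<odot>\<^bsub>A\<^esub> b) = c \<odot>\<^bsub>A\<^esub> (a \<otimes>\<^bsub>A\<^esub> b))"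


section \<open>Tensor products over \<open>K\<close>\<close>

text \<open>The free \<open>K\<close>-module on a set \<open>S\<close>: finitely supported functions vanishing outside \<open>S\<close>.
  It is only used as a module, so its multiplicative fields are irrelevant.\<close>

definition free_module :: "('k, 'c) ring_scheme \<Rightarrow> 'p set \<Rightarrow> ('k, 'p \<Rightarrow> 'k) module"
  where "free_module K S =
    \<lparr>carrier = {f. (\<forall>p. f p \<in> carrier K) \<and> (\<forall>p. p \<notin> S \<longrightarrow> f p = \<zero>\<^bsub>K\<^esub>) \<and> finite {p. f p \<noteq> \<zero>\<^bsub>K\<^esub>}},
     mult = undefined, one = undefined, zero = (\<lambda>p. \<zero>\<^bsub>K\<^esub>), add = (\<lambda>f g p. f p \<oplus>\<^bsub>K\<^esub> g p),
     smult = (\<lambda>c f p. c \<otimes>\<^bsub>K\<^esub> f p)\<rparr>"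

definition free_gen :: "('k, 'c) ring_scheme \<Rightarrow> 'p \<Rightarrow> 'p \<Rightarrow> 'k"
  where "free_gen K p = (\<lambda>q. if q = p then \<one>\<^bsub>K\<^esub> else \<zero>\<^bsub>K\<^esub>)"

type_synonym ('k, 'v, 'w) tens = "('v \<times> 'w \<Rightarrow> 'k) set"

definition tensor_rels ::
  "('k, 'c) ring_scheme \<Rightarrow> ('k, 'v, 'd) module_scheme \<Rightarrow> ('k, 'w, 'e) module_scheme \<Rightarrow> ('v \<times> 'w \<Rightarrow> 'k) set"
  where "tensor_rels K V W =
    (let F = free_module K (carrier V \<times> carrier W); g = (\<lambda>v w. free_gen K (v, w)) in
     lin_span K F
      ({g (v \<oplus>\<^bsub>V\<^esub> v') w \<ominus>\<^bsub>F\<^esub> (g v w \<oplus>\<^bsub>F\<^esub> g v' w) | v v' w.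
          v \<in> carrier V \<and> v' \<in> carrier V \<and> w \<in> carrier W} \<union>
       {g v (w \<oplus>\<^bsub>W\<^esub> w') \<ominus>\<^bsub>F\<^esub> (g v w \<oplus>\<^bsub>F\<^esub> g v w') | v w w'.
          v \<in> carrier V \<and> w \<in> carrier W \<and> w' \<in> carrier W} \<union>
       {g (c \<odot>\<^bsub>V\<^esub> v) w \<ominus>\<^bsub>F\<^esub> c \<odot>\<^bsub>F\<^esub> g v w | c v w.
          c \<in> carrier K \<and> v \<in> carrier V \<and> w \<in> carrier W} \<union>
       {g v (c \<odot>\<^bsub>W\<^esub> w) \<ominus>\<^bsub>F\<^esub> c \<odot>\<^bsub>F\<^esub> g v w | c v w.
          c \<in> carrier K \<and> v \<in> carrier V \<and> w \<in> carrier W}))"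

definition tensor_space ::
  "('k, 'c) ring_scheme \<Rightarrow> ('k, 'v, 'd) module_scheme \<Rightarrow> ('k, 'w, 'e) module_scheme
    \<Rightarrow> ('k, ('k, 'v, 'w) tens) module"
  where "tensor_space K V W =
    quot_module (free_module K (carrier V \<times> carrier W)) (tensor_rels K V W)"

text \<open>The pure tensor of \<open>v\<close> and \<open>w\<close>.\<close>

definition pure ::
  "('k, 'c) ring_scheme \<Rightarrow> ('k, 'v, 'd) module_scheme \<Rightarrow> ('k, 'w, 'e) module_scheme
    \<Rightarrow> 'v \<Rightarrow> 'w \<Rightarrow> ('k, 'v, 'w) tens"
  where "pure K V W v w =
    tensor_rels K V W +>\<^bsub>free_module K (carrier V \<times> carrier W)\<^esub> free_gen K (v, w)"

text \<open>For a bilinear map \<open>\<beta>\<close> with values in \<open>U\<close>, the linear map on the tensor product determined by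
  \<open>v \<otimes> w \<mapsto> \<beta> v w\<close>. All formulas in Sweedler notation below are expressed through it.\<close>

definition tensor_lift ::
  "('k, 'c) ring_scheme \<Rightarrow> ('k, 'u, 'd) module_scheme \<Rightarrow> ('v \<Rightarrow> 'w \<Rightarrow> 'u) \<Rightarrow> ('k, 'v, 'w) tens \<Rightarrow> 'u"
  where "tensor_lift K U \<beta> =
    descend (\<lambda>f. \<Oplus>\<^bsub>U\<^esub>p\<in>{p. f p \<noteq> \<zero>\<^bsub>K\<^esub>}. f p \<odot>\<^bsub>U\<^esub> \<beta> (fst p) (snd p))"

text \<open>The tensor product with the multiplication \<open>(v \<otimes> w)(v' \<otimes> w') = vv' \<otimes> ww'\<close> and unit
  \<open>1 \<otimes> 1\<close>. For factors that are not algebras the two multiplicative fields carry no meaning.\<close>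

definition tensor ::
  "('k, 'c) ring_scheme \<Rightarrow> ('k, 'v, 'd) module_scheme \<Rightarrow> ('k, 'w, 'e) module_scheme
    \<Rightarrow> ('k, ('k, 'v, 'w) tens) module"
  where "tensor K V W = (tensor_space K V W)
    \<lparr>mult := (\<lambda>X Y. tensor_lift K (tensor_space K V W)
        (\<lambda>v w. tensor_lift K (tensor_space K V W)
          (\<lambda>v' w'. pure K V W (v \<otimes>\<^bsub>V\<^esub> v') (w \<otimes>\<^bsub>W\<^esub> w')) Y) X),
     one := pure K V W \<one>\<^bsub>V\<^esub> \<one>\<^bsub>W\<^esub>\<rparr>"

text \<open>\<open>f \<otimes> g\<close> for linear maps \<open>f\<close> into \<open>V\<close> and \<open>g\<close> into \<open>W\<close>.\<close>

definition tensor_map ::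
  "('k, 'c) ring_scheme \<Rightarrow> ('k, 'v, 'd) module_scheme \<Rightarrow> ('k, 'w, 'e) module_scheme
    \<Rightarrow> ('p \<Rightarrow> 'v) \<Rightarrow> ('q \<Rightarrow> 'w) \<Rightarrow> ('k, 'p, 'q) tens \<Rightarrow> ('k, 'v, 'w) tens"
  where "tensor_map K V W f g = tensor_lift K (tensor K V W) (\<lambda>p q. pure K V W (f p) (g q))"

text \<open>\<open>(u \<otimes> v) \<otimes> w \<mapsto> u \<otimes> (v \<otimes> w)\<close>; compositions into threefold tensor products are compared
  after this identification.\<close>

definition tensor_assoc ::
  "('k, 'c) ring_scheme \<Rightarrow> ('k, 'u, 'd) module_scheme \<Rightarrow> ('k, 'v, 'e) module_scheme
    \<Rightarrow> ('k, 'w, 'f) module_scheme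
    \<Rightarrow> ('k, ('k, 'u, 'v) tens, 'w) tens \<Rightarrow> ('k, 'u, ('k, 'v, 'w) tens) tens"
  where "tensor_assoc K U V W =
    tensor_lift K (tensor K U (tensor K V W))
      (\<lambda>x w. tensor_lift K (tensor K U (tensor K V W))
        (\<lambda>u v. pure K U (tensor K V W) u (pure K V W v w)) x)"


section \<open>Hopf algebras\<close>

record ('k, 'h) hopf = "('k, 'h) module" +
  comult :: "'h \<Rightarrow> ('k, 'h, 'h) tens"
  counit :: "'h \<Rightarrow> 'k"
  antipode :: "'h \<Rightarrow> 'h"

definition hopf_algebra :: "('k, 'c) ring_scheme \<Rightarrow> ('k, 'h) hopf \<Rightarrow> bool"
  where "hopf_algebra K H \<longleftrightarrow> field K \<and> assoc_algebra K H \<and>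
    comult H \<in> linear_maps K H (tensor K H H) \<and> comult H \<in> ring_hom H (tensor K H H) \<and>
    counit H \<in> ring_hom H K \<and>
    (\<forall>c\<in>carrier K. \<forall>h\<in>carrier H. counit H (c \<odot>\<^bsub>H\<^esub> h) = c \<otimes>\<^bsub>K\<^esub> counit H h) \<and>
    antipode H \<in> linear_maps K H H \<and>
    (\<forall>h\<in>carrier H.
      tensor_assoc K H H H (tensor_map K (tensor K H H) H (comult H) id (comult H h)) =
        tensor_map K H (tensor K H H) id (comult H) (comult H h) \<and>
      tensor_lift K H (\<lambda>x y. counit H x \<odot>\<^bsub>H\<^esub> y) (comult H h) = h \<and>
      tensor_lift K H (\<lambda>x y. counit H y \<odot>\<^bsub>H\<^esub> x) (comult H h) = h \<and>
      tensor_lift K H (\<lambda>x y. antipode H x \<otimes>\<^bsub>H\<^esub> y) (comult H h) = counit H h \<odot>\<^bsub>H\<^esub> \<one>\<^bsub>H\<^esub> \<and>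
      tensor_lift K H (\<lambda>x y. x \<otimes>\<^bsub>H\<^esub> antipode H y) (comult H h) = counit H h \<odot>\<^bsub>H\<^esub> \<one>\<^bsub>H\<^esub>)"

text \<open>\<open>H\<^sup>+ = ker \<epsilon>\<close> as a module, and \<open>h\<^sup>+ = h - \<epsilon>(h)1\<close>.\<close>

definition aug :: "('k, 'c) ring_scheme \<Rightarrow> ('k, 'h) hopf \<Rightarrow> ('k, 'h) hopf"
  where "aug K H = H\<lparr>carrier := a_kernel H K (counit H)\<rparr>"

definition aug_part :: "('k, 'h) hopf \<Rightarrow> 'h \<Rightarrow> 'h"
  where "aug_part H h = h \<ominus>\<^bsub>H\<^esub> counit H h \<odot>\<^bsub>H\<^esub> \<one>\<^bsub>H\<^esub>"

definition right_ideal :: "'h set \<Rightarrow> ('h, 'd) ring_scheme \<Rightarrow> bool"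
  where "right_ideal I H \<longleftrightarrow> additive_subgroup I H \<and> (\<forall>x\<in>I. \<forall>h\<in>carrier H. x \<otimes>\<^bsub>H\<^esub> h \<in> I)"

text \<open>\<open>Ad\<^sub>R(h) = h\<^sub>(\<^sub>2\<^sub>) \<otimes> S(h\<^sub>(\<^sub>1\<^sub>)) h\<^sub>(\<^sub>3\<^sub>)\<close>, with the first tensor factor of \<open>\<Delta>(h)\<close> split again.\<close>

definition Ad_R :: "('k, 'c) ring_scheme \<Rightarrow> ('k, 'h) hopf \<Rightarrow> 'h \<Rightarrow> ('k, 'h, 'h) tens"
  where "Ad_R K H h =
    tensor_lift K (tensor K H H)
      (\<lambda>x h3. tensor_lift K (tensor K H H)
        (\<lambda>h1 h2. pure K H H h2 (antipode H h1 \<otimes>\<^bsub>H\<^esub> h3)) (comult H x)) (comult H h)"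


section \<open>Principal comodule algebras\<close>

record ('k, 'h, 'a) comod_alg = "('k, 'a) module" +
  coact :: "'a \<Rightarrow> ('k, 'a, 'h) tens"

definition comodule_algebra ::
  "('k, 'c) ring_scheme \<Rightarrow> ('k, 'h) hopf \<Rightarrow> ('k, 'h, 'a) comod_alg \<Rightarrow> bool"
  where "comodule_algebra K H A \<longleftrightarrow> assoc_algebra K A \<and>
    coact A \<in> linear_maps K A (tensor K A H) \<and> coact A \<in> ring_hom A (tensor K A H) \<and>
    (\<forall>a\<in>carrier A.
      tensor_assoc K A H H (tensor_map K (tensor K A H) H (coact A) id (coact A a)) =
        tensor_map K A (tensor K H H) id (comult H) (coact A a) \<and>
      tensor_lift K A (\<lambda>x h. counit H h \<odot>\<^bsub>A\<^esub> x) (coact A a) = a)"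

text \<open>\<open>B = A\<^sup>c\<^sup>o\<^sup>(\<^sup>H\<^sup>)\<close>\<close>

definition coinv ::
  "('k, 'c) ring_scheme \<Rightarrow> ('k, 'h) hopf \<Rightarrow> ('k, 'h, 'a) comod_alg \<Rightarrow> ('k, 'h, 'a) comod_alg"
  where "coinv K H A = A\<lparr>carrier := {b \<in> carrier A. coact A b = pure K A H b \<one>\<^bsub>H\<^esub>}\<rparr>"

text \<open>\<open>A \<otimes>\<^sub>B A\<close> as the quotient of \<open>A \<otimes> A\<close> by the span of all \<open>ab \<otimes> a' - a \<otimes> ba'\<close>.\<close>

definition balancing ::
  "('k, 'c) ring_scheme \<Rightarrow> ('k, 'h) hopf \<Rightarrow> ('k, 'h, 'a) comod_alg \<Rightarrow> ('k, 'a, 'a) tens set"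
  where "balancing K H A = lin_span K (tensor K A A)
    {pure K A A (a \<otimes>\<^bsub>A\<^esub> b) a' \<ominus>\<^bsub>tensor K A A\<^esub> pure K A A a (b \<otimes>\<^bsub>A\<^esub> a') | a b a'.
       a \<in> carrier A \<and> b \<in> carrier (coinv K H A) \<and> a' \<in> carrier A}"

definition tensor_B ::
  "('k, 'c) ring_scheme \<Rightarrow> ('k, 'h) hopf \<Rightarrow> ('k, 'h, 'a) comod_alg
    \<Rightarrow> ('k, ('k, 'a, 'a) tens set) module"
  where "tensor_B K H A = quot_module (tensor K A A) (balancing K H A)"

definition proj_B ::
  "('k, 'c) ring_scheme \<Rightarrow> ('k, 'h) hopf \<Rightarrow> ('k, 'h, 'a) comod_alg
    \<Rightarrow> ('k, 'a, 'a) tens \<Rightarrow> ('k, 'a, 'a) tens set"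
  where "proj_B K H A x = balancing K H A +>\<^bsub>tensor K A A\<^esub> x"

text \<open>\<open>a \<otimes> a' \<mapsto> a a'\<^sub>(\<^sub>0\<^sub>) \<otimes> a'\<^sub>(\<^sub>1\<^sub>)\<close> on \<open>A \<otimes> A\<close>, and the induced map on \<open>A \<otimes>\<^sub>B A\<close>.\<close>

definition can_lift ::
  "('k, 'c) ring_scheme \<Rightarrow> ('k, 'h) hopf \<Rightarrow> ('k, 'h, 'a) comod_alg
    \<Rightarrow> ('k, 'a, 'a) tens \<Rightarrow> ('k, 'a, 'h) tens"
  where "can_lift K H A = tensor_lift K (tensor K A H)
    (\<lambda>a a'. tensor_lift K (tensor K A H) (\<lambda>a0 h. pure K A H (a \<otimes>\<^bsub>A\<^esub> a0) h) (coact A a'))"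

definition can ::
  "('k, 'c) ring_scheme \<Rightarrow> ('k, 'h) hopf \<Rightarrow> ('k, 'h, 'a) comod_alg
    \<Rightarrow> ('k, 'a, 'a) tens set \<Rightarrow> ('k, 'a, 'h) tens"
  where "can K H A = descend (can_lift K H A)"

definition hopf_galois ::
  "('k, 'c) ring_scheme \<Rightarrow> ('k, 'h) hopf \<Rightarrow> ('k, 'h, 'a) comod_alg \<Rightarrow> bool"
  where "hopf_galois K H A \<longleftrightarrow>
    bij_betw (can K H A) (carrier (tensor_B K H A)) (carrier (tensor K A H))"

definition translation ::
  "('k, 'c) ring_scheme \<Rightarrow> ('k, 'h) hopf \<Rightarrow> ('k, 'h, 'a) comod_alg \<Rightarrow> 'h \<Rightarrow> ('k, 'a, 'a) tens set"
  where "translation K H A h =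
    inv_into (carrier (tensor_B K H A)) (can K H A) (pure K A H \<one>\<^bsub>A\<^esub> h)"

text \<open>In the second part, \<open>s\<close> is a left \<open>B\<close>-linear, right \<open>H\<close>-colinear splitting of the
  multiplication \<open>B \<otimes> A \<rightarrow> A\<close>, where \<open>H\<close> coacts on the right factor of \<open>B \<otimes> A\<close>.\<close>

definition principal_comodule_algebra ::
  "('k, 'c) ring_scheme \<Rightarrow> ('k, 'h) hopf \<Rightarrow> ('k, 'h, 'a) comod_alg \<Rightarrow> bool"
  where "principal_comodule_algebra K H A \<longleftrightarrow> comodule_algebra K H A \<and> hopf_galois K H A \<and>
    (\<exists>s \<in> linear_maps K A (tensor K (coinv K H A) A).
      (\<forall>a\<in>carrier A. tensor_lift K A (\<lambda>b a'. b \<otimes>\<^bsub>A\<^esub> a') (s a) = a) \<and>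
      (\<forall>b\<in>carrier (coinv K H A). \<forall>a\<in>carrier A.
        s (b \<otimes>\<^bsub>A\<^esub> a) = tensor_map K (coinv K H A) A (\<lambda>b'. b \<otimes>\<^bsub>A\<^esub> b') id (s a)) \<and>
      (\<forall>a\<in>carrier A.
        tensor_map K (coinv K H A) (tensor K A H) id (coact A) (s a) =
        tensor_assoc K (coinv K H A) A H
          (tensor_map K (tensor K (coinv K H A) A) H s id (coact A a))))"


section \<open>First-order differential calculi\<close>

text \<open>The \<open>A\<close>-bimodule structure of \<open>A \<otimes> A\<close> and the induced one of \<open>A \<otimes>\<^sub>B A\<close>.\<close>

definition lact ::
  "('k, 'c) ring_scheme \<Rightarrow> ('k, 'h, 'a) comod_alg \<Rightarrow> 'a \<Rightarrow> ('k, 'a, 'a) tens \<Rightarrow> ('k, 'a, 'a) tens"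
  where "lact K A a = tensor_map K A A (\<lambda>x. a \<otimes>\<^bsub>A\<^esub> x) id"

definition ract ::
  "('k, 'c) ring_scheme \<Rightarrow> ('k, 'h, 'a) comod_alg \<Rightarrow> 'a \<Rightarrow> ('k, 'a, 'a) tens \<Rightarrow> ('k, 'a, 'a) tens"
  where "ract K A a = tensor_map K A A id (\<lambda>y. y \<otimes>\<^bsub>A\<^esub> a)"

definition lact_B ::
  "('k, 'c) ring_scheme \<Rightarrow> ('k, 'h) hopf \<Rightarrow> ('k, 'h, 'a) comod_alg
    \<Rightarrow> 'a \<Rightarrow> ('k, 'a, 'a) tens set \<Rightarrow> ('k, 'a, 'a) tens set"
  where "lact_B K H A a = descend (\<lambda>x. proj_B K H A (lact K A a x))"

definition ract_B ::
  "('k, 'c) ring_scheme \<Rightarrow> ('k, 'h) hopf \<Rightarrow> ('k, 'h, 'a) comod_alg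
    \<Rightarrow> 'a \<Rightarrow> ('k, 'a, 'a) tens set \<Rightarrow> ('k, 'a, 'a) tens set"
  where "ract_B K H A a = descend (\<lambda>x. proj_B K H A (ract K A a x))"

definition subbimodule ::
  "('k, 'c) ring_scheme \<Rightarrow> ('k, 'h, 'a) comod_alg \<Rightarrow> ('k, 'm, 'd) module_scheme
    \<Rightarrow> ('a \<Rightarrow> 'm \<Rightarrow> 'm) \<Rightarrow> ('a \<Rightarrow> 'm \<Rightarrow> 'm) \<Rightarrow> 'm set \<Rightarrow> bool"
  where "subbimodule K A M l r N \<longleftrightarrow>
    submodule N K M \<and> (\<forall>a\<in>carrier A. \<forall>x\<in>N. l a x \<in> N \<and> r a x \<in> N)"

definition univ_calc ::
  "('k, 'c) ring_scheme \<Rightarrow> ('k, 'h, 'a) comod_alg \<Rightarrow> ('k, ('k, 'a, 'a) tens) module"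
  where "univ_calc K A = (tensor K A A)
    \<lparr>carrier := a_kernel (tensor K A A) A (tensor_lift K A (\<lambda>a a'. a \<otimes>\<^bsub>A\<^esub> a'))\<rparr>"

text \<open>The diagonal coaction \<open>a \<otimes> a' \<mapsto> a\<^sub>(\<^sub>0\<^sub>) \<otimes> a'\<^sub>(\<^sub>0\<^sub>) \<otimes> a\<^sub>(\<^sub>1\<^sub>) a'\<^sub>(\<^sub>1\<^sub>)\<close>.\<close>

definition diag_coact ::
  "('k, 'c) ring_scheme \<Rightarrow> ('k, 'h) hopf \<Rightarrow> ('k, 'h, 'a) comod_alg
    \<Rightarrow> ('k, 'a, 'a) tens \<Rightarrow> ('k, ('k, 'a, 'a) tens, 'h) tens"
  where "diag_coact K H A =
    (let T = tensor K (tensor K A A) H in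
     tensor_lift K T (\<lambda>a a'.
       tensor_lift K T (\<lambda>a0 h.
         tensor_lift K T (\<lambda>a0' h'. pure K (tensor K A A) H (pure K A A a0 a0') (h \<otimes>\<^bsub>H\<^esub> h'))
           (coact A a'))
         (coact A a)))"

text \<open>\<open>N\<close> is a subbimodule of the universal calculus and a subcomodule for the diagonal coaction;
  it presents the right covariant calculus \<open>quot_module (univ_calc K A) N\<close>. As \<open>K\<close> is a field,
  \<open>N \<otimes> H\<close> is identified with the span of its pure tensors in \<open>(A \<otimes> A) \<otimes> H\<close>.\<close>

definition covariant_calculus ::
  "('k, 'c) ring_scheme \<Rightarrow> ('k, 'h) hopf \<Rightarrow> ('k, 'h, 'a) comod_alg \<Rightarrow> ('k, 'a, 'a) tens set \<Rightarrow> bool"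
  where "covariant_calculus K H A N \<longleftrightarrow>
    subbimodule K A (univ_calc K A) (lact K A) (ract K A) N \<and>
    diag_coact K H A ` N \<subseteq> lin_span K (tensor K (tensor K A A) H)
      {pure K (tensor K A A) H n h | n h. n \<in> N \<and> h \<in> carrier H}"


section \<open>The braiding, connections and generated calculi\<close>

text \<open>\<open>\<sigma>(a \<otimes>\<^sub>B a') = a\<^sub>(\<^sub>0\<^sub>) a' \<tau>(a\<^sub>(\<^sub>1\<^sub>))\<close>\<close>

definition sigma ::
  "('k, 'c) ring_scheme \<Rightarrow> ('k, 'h) hopf \<Rightarrow> ('k, 'h, 'a) comod_alg
    \<Rightarrow> ('k, 'a, 'a) tens set \<Rightarrow> ('k, 'a, 'a) tens set"
  where "sigma K H A = descend (tensor_lift K (tensor_B K H A)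
    (\<lambda>a a'. tensor_lift K (tensor_B K H A)
      (\<lambda>a0 h. lact_B K H A (a0 \<otimes>\<^bsub>A\<^esub> a') (translation K H A h)) (coact A a)))"

definition sigma_hull ::
  "('k, 'c) ring_scheme \<Rightarrow> ('k, 'h) hopf \<Rightarrow> ('k, 'h, 'a) comod_alg
    \<Rightarrow> ('k, 'a, 'a) tens set set \<Rightarrow> ('k, 'a, 'a) tens set set"
  where "sigma_hull K H A W =
    \<Inter>{V. submodule V K (tensor_B K H A) \<and> sigma K H A ` V = V \<and> W \<subseteq> V}"

definition generated_subbimodule ::
  "('k, 'c) ring_scheme \<Rightarrow> ('k, 'h) hopf \<Rightarrow> ('k, 'h, 'a) comod_alg
    \<Rightarrow> ('k, 'a, 'a) tens set set \<Rightarrow> ('k, 'a, 'a) tens set set"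
  where "generated_subbimodule K H A W =
    \<Inter>{N. subbimodule K A (tensor_B K H A) (lact_B K H A) (ract_B K H A) N \<and> W \<subseteq> N}"

definition strong_connection ::
  "('k, 'c) ring_scheme \<Rightarrow> ('k, 'h) hopf \<Rightarrow> ('k, 'h, 'a) comod_alg
    \<Rightarrow> ('h \<Rightarrow> ('k, 'a, 'a) tens) \<Rightarrow> bool"
  where "strong_connection K H A l \<longleftrightarrow> l \<in> linear_maps K H (tensor K A A) \<and>
    l \<one>\<^bsub>H\<^esub> = pure K A A \<one>\<^bsub>A\<^esub> \<one>\<^bsub>A\<^esub> \<and>
    (\<forall>h\<in>carrier H.
      tensor_map K A (tensor K A H) id (coact A) (l h) =
        tensor_assoc K A A H (tensor_map K (tensor K A A) H l id (comult H h)) \<and>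
      can_lift K H A (l h) = pure K A H \<one>\<^bsub>A\<^esub> h)"

text \<open>\<open>a \<otimes> a' \<mapsto> a a'\<^sub>(\<^sub>0\<^sub>) \<otimes> (a'\<^sub>(\<^sub>1\<^sub>))\<^sup>+\<close>\<close>

definition ver ::
  "('k, 'c) ring_scheme \<Rightarrow> ('k, 'h) hopf \<Rightarrow> ('k, 'h, 'a) comod_alg
    \<Rightarrow> ('k, 'a, 'a) tens \<Rightarrow> ('k, 'a, 'h) tens"
  where "ver K H A = tensor_lift K (tensor K A (aug K H))
    (\<lambda>a a'. tensor_lift K (tensor K A (aug K H))
      (\<lambda>a0 h. pure K A (aug K H) (a \<otimes>\<^bsub>A\<^esub> a0) (aug_part H h)) (coact A a'))"

text \<open>\<open>Ad\<^sub>R\<close> maps \<open>H\<^sup>+\<close> into \<open>H\<^sup>+ \<otimes> H\<close>, but its values are elements of \<open>H \<otimes> H\<close> here. As \<open>\<omega>\<close> is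
  meaningful only on \<open>H\<^sup>+\<close>, it is precomposed with the projection \<open>h \<mapsto> h\<^sup>+\<close>, which is the identity
  on \<open>H\<^sup>+\<close>.\<close>

definition connection_form ::
  "('k, 'c) ring_scheme \<Rightarrow> ('k, 'h) hopf \<Rightarrow> ('k, 'h, 'a) comod_alg
    \<Rightarrow> ('h \<Rightarrow> ('k, 'a, 'a) tens) \<Rightarrow> bool"
  where "connection_form K H A \<omega> \<longleftrightarrow> \<omega> \<in> linear_maps K (aug K H) (univ_calc K A) \<and>
    (\<forall>x\<in>carrier (aug K H).
      ver K H A (\<omega> x) = pure K A (aug K H) \<one>\<^bsub>A\<^esub> x \<and>
      diag_coact K H A (\<omega> x) =
        tensor_map K (tensor K A A) H (\<lambda>h. \<omega> (aug_part H h)) id (Ad_R K H x))"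

text \<open>\<open>\<omega>\<close> is the connection form associated with the strong connection \<open>l\<close>.\<close>

definition associated_form ::
  "('k, 'c) ring_scheme \<Rightarrow> ('k, 'h) hopf \<Rightarrow> ('k, 'h, 'a) comod_alg
    \<Rightarrow> ('h \<Rightarrow> ('k, 'a, 'a) tens) \<Rightarrow> ('h \<Rightarrow> ('k, 'a, 'a) tens) \<Rightarrow> bool"
  where "associated_form K H A l \<omega> \<longleftrightarrow> connection_form K H A \<omega> \<and>
    (\<forall>h\<in>carrier H. \<omega> (aug_part H h) =
      l h \<ominus>\<^bsub>tensor K A A\<^esub> counit H h \<odot>\<^bsub>tensor K A A\<^esub> pure K A A \<one>\<^bsub>A\<^esub> \<one>\<^bsub>A\<^esub>)"

text \<open>\<open>sigma_generated_via\<close> exhibits the witnesses \<open>l\<close> and \<open>\<omega>\<close> of \<open>sigma_generated\<close>.\<close>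

definition sigma_generated_via ::
  "('k, 'c) ring_scheme \<Rightarrow> ('k, 'h) hopf \<Rightarrow> ('k, 'h, 'a) comod_alg
    \<Rightarrow> 'h set \<Rightarrow> ('k, 'a, 'a) tens set \<Rightarrow> ('h \<Rightarrow> ('k, 'a, 'a) tens) \<Rightarrow> ('h \<Rightarrow> ('k, 'a, 'a) tens) \<Rightarrow> bool"
  where "sigma_generated_via K H A I N l \<omega> \<longleftrightarrow> covariant_calculus K H A N \<and>
    a_kernel (tensor K A A) (tensor_B K H A) (proj_B K H A) \<subseteq> N \<and>
    strong_connection K H A l \<and> associated_form K H A l \<omega> \<and>
    proj_B K H A ` N =
      generated_subbimodule K H A (sigma_hull K H A (proj_B K H A ` \<omega> ` I))"

definition sigma_generated ::
  "('k, 'c) ring_scheme \<Rightarrow> ('k, 'h) hopf \<Rightarrow> ('k, 'h, 'a) comod_alg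
    \<Rightarrow> 'h set \<Rightarrow> ('k, 'a, 'a) tens set \<Rightarrow> bool"
  where "sigma_generated K H A I N \<longleftrightarrow> (\<exists>l \<omega>. sigma_generated_via K H A I N l \<omega>)"

end

theory Submission
  imports Defs
begin

text \<open>The content is \<open>\<omega>(I) \<subseteq> N\<close>: by \<open>\<sigma>\<close>-generation \<open>\<pi>(\<omega>(I)) \<subseteq> \<pi>(N)\<close>, so every \<open>\<omega>(i)\<close> differs from
  an element of \<open>N\<close> by an element of \<open>ker \<pi> \<subseteq> N\<close>.\<close>

section \<open>Submodules, spans and quotient modules\<close>

text \<open>Closure under negation comes for free from closure under scalars, since
  \<open>-x = (-1)x\<close>.\<close>

lemma (in module) submoduleI_smult:
  assumes sub: "N \<subseteq> carrier M" and zero: "\<zero>\<^bsub>M\<^esub> \<in> N"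
    and add: "\<And>x y. x \<in> N \<Longrightarrow> y \<in> N \<Longrightarrow> x \<oplus>\<^bsub>M\<^esub> y \<in> N"
    and smult: "\<And>c x. c \<in> carrier R \<Longrightarrow> x \<in> N \<Longrightarrow> c \<odot>\<^bsub>M\<^esub> x \<in> N"
  shows "submodule N R M"
proof (rule submoduleI[OF sub zero _ add smult])
  fix x assume x: "x \<in> N"
  have "\<ominus>\<^bsub>M\<^esub> x = (\<ominus>\<^bsub>R\<^esub> \<one>\<^bsub>R\<^esub>) \<odot>\<^bsub>M\<^esub> x"
    using x sub smult_l_minus[of "\<one>\<^bsub>R\<^esub>" x] by auto
  then show "\<ominus>\<^bsub>M\<^esub> x \<in> N"
    using smult[of "\<ominus>\<^bsub>R\<^esub> \<one>\<^bsub>R\<^esub>" x] x by simp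
qed auto

text \<open>Shrinking the carrier leaves all operations unchanged, so the closure conditions carry
  over. This lets a subbimodule \<open>N\<close> of \<open>univ_calc K A\<close> be treated inside
  the ambient \<open>tensor K A A\<close>.\<close>

lemma (in module) submodule_of_restrict:
  assumes N: "submodule N R (M\<lparr>carrier := C\<rparr>)" and C: "C \<subseteq> carrier M"
  shows "submodule N R M"
proof (rule submoduleI_smult)
  interpret N: submodule N R "M\<lparr>carrier := C\<rparr>" by (rule N)
  show "N \<subseteq> carrier M" using N.subset C by auto
  show "\<zero>\<^bsub>M\<^esub> \<in> N" using N.one_closed by simp
  show "x \<oplus>\<^bsub>M\<^esub> y \<in> N" if "x \<in> N" "y \<in> N" for x y using N.m_closed[OF that] by simp
  show "c \<odot>\<^bsub>M\<^esub> x \<in> N" if "c \<in> carrier R" "x \<in> N" for c x using N.smult_closed[OF that] by simp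
qed

lemma (in module) submodule_imp_abelian_subgroup:
  assumes "submodule N R M"
  shows "abelian_subgroup N M"
  by (rule abelian_subgroupI3[OF additive_subgroupI[OF submodule.axioms(1)[OF assms]]
        M.abelian_group_axioms])

text \<open>The family being intersected is nonempty, because \<open>carrier M\<close> belongs to
  it; so the intersection stays inside the carrier and inherits every closure property.\<close>

lemma (in module) lin_span_submodule:
  assumes "X \<subseteq> carrier M"
  shows "submodule (lin_span R M X) R M"
proof -
  let ?F = "{N. submodule N R M \<and> X \<subseteq> N}"
  have top: "carrier M \<in> ?F" using assms carrier_is_submodule by simp
  have ag: "additive_subgroup N M" if "N \<in> ?F" for N
    using that submodule.axioms(1) by (auto intro: additive_subgroupI)
  show ?thesis unfolding lin_span_def
  proof (rule submoduleI_smult)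
    show "\<Inter>?F \<subseteq> carrier M" using top by (rule Inter_lower)
    show "\<zero>\<^bsub>M\<^esub> \<in> \<Inter>?F" using additive_subgroup.zero_closed[OF ag] by blast
    show "x \<oplus>\<^bsub>M\<^esub> y \<in> \<Inter>?F" if "x \<in> \<Inter>?F" "y \<in> \<Inter>?F" for x y
      using that additive_subgroup.a_closed[OF ag] by blast
    show "c \<odot>\<^bsub>M\<^esub> x \<in> \<Inter>?F" if "c \<in> carrier R" "x \<in> \<Inter>?F" for c x
      using that submodule.smult_closed[of _ R M c x] by blast
  qed
qed

text \<open>Scalar multiplication in \<open>quot_module\<close> is a union over all representatives.
  Since \<open>N\<close> is closed under scalars, every member of that union is the same coset, and
  the union is over a nonempty set because \<open>x\<close> represents its own coset.\<close>

lemma (in module) quot_smult: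
  assumes N: "submodule N R M" and c: "c \<in> carrier R" and x: "x \<in> carrier M"
  shows "c \<odot>\<^bsub>quot_module M N\<^esub> (N +>\<^bsub>M\<^esub> x) = N +>\<^bsub>M\<^esub> (c \<odot>\<^bsub>M\<^esub> x)"
proof -
  interpret N: abelian_subgroup N M by (rule submodule_imp_abelian_subgroup[OF N])
  have "N +>\<^bsub>M\<^esub> (c \<odot>\<^bsub>M\<^esub> y) = N +>\<^bsub>M\<^esub> (c \<odot>\<^bsub>M\<^esub> x)" if y: "y \<in> N +>\<^bsub>M\<^esub> x" for y
  proof -
    obtain n where n: "n \<in> N" "y = n \<oplus>\<^bsub>M\<^esub> x"
      using y by (auto simp: a_r_coset_def')
    have "c \<odot>\<^bsub>M\<^esub> y = c \<odot>\<^bsub>M\<^esub> n \<oplus>\<^bsub>M\<^esub> c \<odot>\<^bsub>M\<^esub> x"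
      using n c x N.a_subset by (auto intro: smult_r_distr)
    moreover have "c \<odot>\<^bsub>M\<^esub> n \<in> N" using submodule.smult_closed[OF N c] n by simp
    ultimately have "c \<odot>\<^bsub>M\<^esub> y \<in> N +>\<^bsub>M\<^esub> (c \<odot>\<^bsub>M\<^esub> x)"
      by (auto simp: a_r_coset_def')
    then show ?thesis using c x N.a_repr_independence' by blast
  qed
  then have "(\<Union>y\<in>N +>\<^bsub>M\<^esub> x. N +>\<^bsub>M\<^esub> (c \<odot>\<^bsub>M\<^esub> y)) = (\<Union>y\<in>N +>\<^bsub>M\<^esub> x. N +>\<^bsub>M\<^esub> (c \<odot>\<^bsub>M\<^esub> x))"
    by (intro SUP_cong refl)
  moreover have "N +>\<^bsub>M\<^esub> x \<noteq> {}" using N.a_rcos_self[OF x] by blast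
  ultimately show ?thesis by (simp add: quot_module_def)
qed

lemma (in module) quot_add:
  assumes N: "submodule N R M" and x: "x \<in> carrier M" and y: "y \<in> carrier M"
  shows "(N +>\<^bsub>M\<^esub> x) \<oplus>\<^bsub>quot_module M N\<^esub> (N +>\<^bsub>M\<^esub> y) = N +>\<^bsub>M\<^esub> (x \<oplus>\<^bsub>M\<^esub> y)"
proof -
  interpret N: abelian_subgroup N M by (rule submodule_imp_abelian_subgroup[OF N])
  show ?thesis using x y N.a_rcos_sum by (simp add: quot_module_def)
qed

lemma carrier_quot_module: "carrier (quot_module M N) = (\<lambda>x. N +>\<^bsub>M\<^esub> x) ` carrier M"
  by (auto simp: quot_module_def A_RCOSETS_def')

text \<open>Each element is the coset of a representative, and the operations act on
  representatives, so every axiom reduces to the same axiom in \<open>M\<close>.\<close>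

lemma (in module) quot_module_is_module:
  assumes N: "submodule N R M"
  shows "module R (quot_module M N)"
proof -
  interpret N: abelian_subgroup N M by (rule submodule_imp_abelian_subgroup[OF N])
  note q = carrier_quot_module quot_add[OF N] quot_smult[OF N]
  \<comment> \<open>The zero field is \<open>N\<close> itself; as the coset of zero it can be
    handled by the same rewriting as all other elements.\<close>
  have z: "\<zero>\<^bsub>quot_module M N\<^esub> = N +>\<^bsub>M\<^esub> \<zero>\<^bsub>M\<^esub>"
    using N.a_subset by (simp add: quot_module_def)
  show ?thesis
  proof (rule moduleI)
    show "abelian_group (quot_module M N)"
    proof (rule abelian_groupI)
      show "\<exists>Y\<in>carrier (quot_module M N). Y \<oplus>\<^bsub>quot_module M N\<^esub> X = \<zero>\<^bsub>quot_module M N\<^esub>"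
        if X: "X \<in> carrier (quot_module M N)" for X
      proof -
        obtain x where x: "x \<in> carrier M" "X = N +>\<^bsub>M\<^esub> x" using X by (auto simp: q)
        then show ?thesis
          by (auto simp: q z M.l_neg intro!: bexI[of _ "\<ominus>\<^bsub>M\<^esub> x"])
      qed
    qed (auto simp: q z M.a_ac)
  qed (auto simp: q smult_l_distr smult_r_distr smult_assoc1 intro: R.is_cring)
qed

text \<open>Replacing \<open>x\<close> by \<open>i + x\<close> with \<open>i\<close> in
  \<open>I\<close> changes \<open>f x\<close> by \<open>f i\<close>, which lies in \<open>N\<close>.
  The coset of \<open>f x\<close> is therefore constant on cosets of \<open>I\<close>, and linearity
  passes to the induced map through representatives.\<close>

lemma (in module) linear_map_descends:
  assumes W: "module R W" and I: "submodule I R M" and N: "submodule N R W"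
    and f: "f \<in> linear_maps R M W" and IN: "f ` I \<subseteq> N"
  shows "\<exists>g \<in> linear_maps R (quot_module M I) (quot_module W N).
    \<forall>x\<in>carrier M. g (I +>\<^bsub>M\<^esub> x) = N +>\<^bsub>W\<^esub> f x"
proof -
  interpret W: module R W by (rule W)
  interpret I: abelian_subgroup I M by (rule submodule_imp_abelian_subgroup[OF I])
  interpret N: abelian_subgroup N W by (rule W.submodule_imp_abelian_subgroup[OF N])
  have fc: "f x \<in> carrier W" if "x \<in> carrier M" for x using f that by (auto simp: linear_maps_def)
  have fa: "f (x \<oplus>\<^bsub>M\<^esub> y) = f x \<oplus>\<^bsub>W\<^esub> f y" if "x \<in> carrier M" "y \<in> carrier M" for x y
    using f that by (auto simp: linear_maps_def)
  have fs: "f (c \<odot>\<^bsub>M\<^esub> x) = c \<odot>\<^bsub>W\<^esub> f x" if "c \<in> carrier R" "x \<in> carrier M" for c x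
    using f that by (auto simp: linear_maps_def)
  define g where "g = descend (\<lambda>x. N +>\<^bsub>W\<^esub> f x)"
  have g: "g (I +>\<^bsub>M\<^esub> x) = N +>\<^bsub>W\<^esub> f x" if x: "x \<in> carrier M" for x
  proof -
    have "N +>\<^bsub>W\<^esub> f y = N +>\<^bsub>W\<^esub> f x" if y: "y \<in> I +>\<^bsub>M\<^esub> x" for y
    proof -
      obtain i where i: "i \<in> I" "y = i \<oplus>\<^bsub>M\<^esub> x" using y by (auto simp: a_r_coset_def')
      then have "f y = f i \<oplus>\<^bsub>W\<^esub> f x" using I.a_subset x by (auto intro: fa)
      moreover have "f i \<in> N" using i IN by auto
      ultimately have "f y \<in> N +>\<^bsub>W\<^esub> f x" by (auto simp: a_r_coset_def')
      then show ?thesis using fc[OF x] N.a_repr_independence' by blast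
    qed
    then have "(\<lambda>y. N +>\<^bsub>W\<^esub> f y) ` (I +>\<^bsub>M\<^esub> x) = (\<lambda>_. N +>\<^bsub>W\<^esub> f x) ` (I +>\<^bsub>M\<^esub> x)"
      by (rule image_cong[OF refl])
    \<comment> \<open>Nonemptiness makes the image of the constant map a singleton, on which
      \<open>the_elem\<close> returns the intended value.\<close>
    moreover have "I +>\<^bsub>M\<^esub> x \<noteq> {}" using I.a_rcos_self[OF x] by blast
    ultimately show ?thesis by (simp add: g_def descend_def image_constant_conv)
  qed
  have "g \<in> linear_maps R (quot_module M I) (quot_module W N)"
    unfolding linear_maps_def carrier_quot_module
    by (auto simp: quot_add[OF I] quot_smult[OF I] g fc fa fs
        W.quot_add[OF N] W.quot_smult[OF N])
  then show ?thesis using g by blast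
qed

section \<open>Tensor products as modules\<close>

text \<open>The operations are pointwise, so the point to check is finiteness of supports: that of a
  sum lies in the union of the two supports, that of a multiple or a negative in the original
  support.\<close>

lemma free_module_is_module:
  assumes "cring K"
  shows "module K (free_module K S)"
proof -
  interpret K: cring K by (rule assms)
  have add: "finite {p. f p \<oplus>\<^bsub>K\<^esub> g p \<noteq> \<zero>\<^bsub>K\<^esub>}"
    if "finite {p. f p \<noteq> \<zero>\<^bsub>K\<^esub>}" "finite {p. g p \<noteq> \<zero>\<^bsub>K\<^esub>}" for f g
    by (rule finite_subset[OF _ finite_UnI[OF that]]) auto
  have smult: "finite {p. c \<otimes>\<^bsub>K\<^esub> f p \<noteq> \<zero>\<^bsub>K\<^esub>}"
    if "finite {p. f p \<noteq> \<zero>\<^bsub>K\<^esub>}" "c \<in> carrier K" for c f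
    by (rule finite_subset[OF _ that(1)]) (use that(2) in auto)
  show ?thesis
  proof (rule moduleI)
    show "abelian_group (free_module K S)"
    proof (rule abelian_groupI)
      show "\<exists>g\<in>carrier (free_module K S). g \<oplus>\<^bsub>free_module K S\<^esub> f = \<zero>\<^bsub>free_module K S\<^esub>"
        if f: "f \<in> carrier (free_module K S)" for f
      proof (rule bexI[of _ "\<lambda>p. \<ominus>\<^bsub>K\<^esub> f p"])
        have "{p. \<ominus>\<^bsub>K\<^esub> f p \<noteq> \<zero>\<^bsub>K\<^esub>} \<subseteq> {p. f p \<noteq> \<zero>\<^bsub>K\<^esub>}" by auto
        then show "(\<lambda>p. \<ominus>\<^bsub>K\<^esub> f p) \<in> carrier (free_module K S)"
          using f by (auto simp: free_module_def intro: finite_subset)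
      qed (use f in \<open>simp add: free_module_def K.l_neg\<close>)
    qed (auto simp: free_module_def K.a_ac add)
  qed (auto simp: free_module_def smult K.l_distr K.r_distr K.m_assoc intro: K.is_cring)
qed

lemma free_gen_closed:
  assumes "cring K" and "p \<in> S"
  shows "free_gen K p \<in> carrier (free_module K S)"
proof -
  interpret K: cring K by (rule assms)
  show ?thesis
    using assms(2) by (auto simp: free_module_def free_gen_def intro: finite_subset[of _ "{p}"])
qed

text \<open>All bilinearity relators are combinations of generators indexed by
  \<open>carrier V \<times> carrier W\<close>, hence lie in the free module, and their span is a
  submodule.\<close>

lemma tensor_rels_submodule:
  assumes V: "module K V" and W: "module K W"
  shows "submodule (tensor_rels K V W) K (free_module K (carrier V \<times> carrier W))"
proof -
  interpret V: module K V by (rule V)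
  interpret W: module K W by (rule W)
  interpret F: module K "free_module K (carrier V \<times> carrier W)"
    by (rule free_module_is_module) (rule V.R.is_cring)
  show ?thesis
    unfolding tensor_rels_def Let_def
    by (rule F.lin_span_submodule)
      (auto intro!: F.M.minus_closed F.M.a_closed F.smult_closed free_gen_closed V.R.is_cring)
qed

text \<open>The module axioms do not mention the fields \<open>mult\<close> and \<open>one\<close>,
  which are exactly those that \<open>tensor\<close> overwrites in
  \<open>tensor_space\<close>.\<close>

lemma module_change_mult:
  assumes "module K V"
  shows "module K (V\<lparr>mult := m, one := u\<rparr>)"
proof -
  interpret V: module K V by (rule assms)
  show ?thesis
  proof (rule moduleI)
    show "abelian_group (V\<lparr>mult := m, one := u\<rparr>)"
      by (rule abelian_groupI) (auto simp: V.M.a_ac intro: V.M.l_neg V.M.a_inv_closed)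
  qed (auto simp: V.smult_l_distr V.smult_r_distr V.smult_assoc1 intro: V.R.is_cring)
qed

lemma tensor_is_module:
  assumes V: "module K V" and W: "module K W"
  shows "module K (tensor K V W)"
proof -
  have "cring K" using V by (rule module.axioms)
  then have "module K (tensor_space K V W)"
    unfolding tensor_space_def
    by (intro module.quot_module_is_module free_module_is_module tensor_rels_submodule V W)
  then show ?thesis unfolding tensor_def by (rule module_change_mult)
qed

lemma pure_closed:
  assumes "cring K" and "v \<in> carrier V" and "w \<in> carrier W"
  shows "pure K V W v w \<in> carrier (tensor K V W)"
  using assms free_gen_closed[of K "(v, w)" "carrier V \<times> carrier W"]
  by (simp add: tensor_def tensor_space_def carrier_quot_module pure_def)

section \<open>The connection form on the ideal\<close>

text \<open>Coinvariants lie in \<open>A\<close>, so each generator is a difference of pure tensors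
  in \<open>tensor K A A\<close>. With this, the fibres of \<open>proj_B\<close> are cosets of a
  subgroup.\<close>

lemma balancing_submodule:
  assumes A: "assoc_algebra K A"
  shows "submodule (balancing K H A) K (tensor K A A)"
proof -
  interpret AM: module K A using A by (simp add: assoc_algebra_def)
  interpret AR: ring A using A by (simp add: assoc_algebra_def)
  interpret T: module K "tensor K A A" by (intro tensor_is_module AM.module_axioms)
  show ?thesis
    unfolding balancing_def
    by (rule T.lin_span_submodule)
      (auto simp: coinv_def intro!: T.M.minus_closed pure_closed AM.R.is_cring)
qed

text \<open>This inclusion is the hypothesis \<open>IN\<close> that
  \<open>linear_map_descends\<close> requires of the connection form.\<close>

lemma sigma_generated_form_maps_ideal:
  assumes A: "assoc_algebra K A" and I: "I \<subseteq> carrier (aug K H)"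
    and gen: "sigma_generated_via K H A I N l \<omega>"
  shows "\<omega> ` I \<subseteq> N"
proof
  fix y assume y: "y \<in> \<omega> ` I"
  interpret AM: module K A using A by (simp add: assoc_algebra_def)
  interpret T: module K "tensor K A A" by (intro tensor_is_module AM.module_axioms)
  let ?B = "balancing K H A"
  interpret B: abelian_subgroup ?B "tensor K A A"
    by (intro T.submodule_imp_abelian_subgroup balancing_submodule A)
  have "submodule N K (univ_calc K A)"
    using gen by (simp add: sigma_generated_via_def covariant_calculus_def subbimodule_def)
  then have N: "submodule N K (tensor K A A)"
    unfolding univ_calc_def by (rule T.submodule_of_restrict) (auto simp: a_kernel_def')
  interpret N: abelian_subgroup N "tensor K A A" by (rule T.submodule_imp_abelian_subgroup[OF N])
  have "\<omega> \<in> carrier (aug K H) \<rightarrow> carrier (univ_calc K A)"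
    using gen by (simp add: sigma_generated_via_def associated_form_def connection_form_def linear_maps_def)
  then have "y \<in> carrier (univ_calc K A)" using y I by blast
  then have yT: "y \<in> carrier (tensor K A A)" by (simp add: univ_calc_def a_kernel_def')
  \<comment> \<open>Both the \<sigma>-hull and the generated subbimodule are intersections of sets
    containing their generators, so each contains what it is generated by.\<close>
  have "proj_B K H A y \<in> sigma_hull K H A (proj_B K H A ` \<omega> ` I)"
    using y by (auto simp: sigma_hull_def)
  then have "proj_B K H A y \<in> proj_B K H A ` N"
    using gen by (auto simp: sigma_generated_via_def generated_subbimodule_def)
  then obtain n where n: "n \<in> N" "?B +>\<^bsub>tensor K A A\<^esub> y = ?B +>\<^bsub>tensor K A A\<^esub> n"
    by (auto simp: proj_B_def)
  then have "y \<in> ?B +>\<^bsub>tensor K A A\<^esub> n" using B.a_rcos_self[OF yT] by simp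
  then obtain b where b: "b \<in> ?B" "y = b \<oplus>\<^bsub>tensor K A A\<^esub> n" by (auto simp: a_r_coset_def')
  \<comment> \<open>The coset of an element of \<open>?B\<close> is \<open>?B\<close> itself, which
    is the zero of \<open>tensor_B K H A\<close>; hence \<open>b\<close> lies in the kernel of the
    projection.\<close>
  have "proj_B K H A b = ?B"
    using b T.a_coset_join2[OF _ B.a_subgroup] by (simp add: proj_B_def)
  then have "b \<in> a_kernel (tensor K A A) (tensor_B K H A) (proj_B K H A)"
    using b by (simp add: a_kernel_def' tensor_B_def quot_module_def)
  then have "b \<in> N" using gen by (auto simp: sigma_generated_via_def)
  then show "y \<in> N" using b n by simp
qed

section \<open>The augmentation ideal and its right ideals\<close>

text \<open>The counit is additive and \<open>K\<close>-linear, so its kernel is a submodule of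
  \<open>H\<close>.\<close>

lemma aug_is_module:
  assumes "hopf_algebra K H"
  shows "module K (aug K H)"
proof -
  interpret HM: module K H using assms by (simp add: hopf_algebra_def assoc_algebra_def)
  interpret HR: ring H using assms by (simp add: hopf_algebra_def assoc_algebra_def)
  have \<epsilon>: "counit H \<in> ring_hom H K" using assms by (simp add: hopf_algebra_def)
  have \<epsilon>_smult: "counit H (c \<odot>\<^bsub>H\<^esub> h) = c \<otimes>\<^bsub>K\<^esub> counit H h"
    if "c \<in> carrier K" "h \<in> carrier H" for c h
    using assms that by (simp add: hopf_algebra_def)
  have "submodule (a_kernel H K (counit H)) K H"
  proof (rule HM.submoduleI_smult)
    show "\<zero>\<^bsub>H\<^esub> \<in> a_kernel H K (counit H)"
      using ring_hom_zero[OF \<epsilon> HR.ring_axioms HM.R.ring_axioms] by (simp add: a_kernel_def')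
    show "x \<oplus>\<^bsub>H\<^esub> y \<in> a_kernel H K (counit H)"
      if "x \<in> a_kernel H K (counit H)" "y \<in> a_kernel H K (counit H)" for x y
      using that by (simp add: a_kernel_def' ring_hom_add[OF \<epsilon>])
    show "c \<odot>\<^bsub>H\<^esub> x \<in> a_kernel H K (counit H)"
      if "c \<in> carrier K" "x \<in> a_kernel H K (counit H)" for c x
      using that by (simp add: a_kernel_def' \<epsilon>_smult)
  qed (simp add: a_kernel_def' subset_iff)
  then show ?thesis
    unfolding aug_def by (rule submodule.submodule_is_module) (rule HM.module_axioms)
qed

text \<open>A right ideal is closed under scalars because \<open>H\<close> is unital:
  \<open>cx = x(c1)\<close>, a right multiple of \<open>x\<close>.\<close>

lemma right_ideal_submodule_aug:
  assumes H: "hopf_algebra K H" and I: "right_ideal I H" and sub: "I \<subseteq> carrier (aug K H)"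
  shows "submodule I K (aug K H)"
proof -
  interpret HM: module K H using H by (simp add: hopf_algebra_def assoc_algebra_def)
  interpret HR: ring H using H by (simp add: hopf_algebra_def assoc_algebra_def)
  interpret I: additive_subgroup I H using I by (simp add: right_ideal_def)
  show ?thesis
  proof (rule module.submoduleI_smult[OF aug_is_module[OF H] sub])
    fix c x assume c: "c \<in> carrier K" and x: "x \<in> I"
    then have "x \<otimes>\<^bsub>H\<^esub> (c \<odot>\<^bsub>H\<^esub> \<one>\<^bsub>H\<^esub>) = c \<odot>\<^bsub>H\<^esub> x"
      using H I.a_subset by (auto simp: hopf_algebra_def assoc_algebra_def)
    moreover have "x \<otimes>\<^bsub>H\<^esub> (c \<odot>\<^bsub>H\<^esub> \<one>\<^bsub>H\<^esub>) \<in> I"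
      using I c x by (simp add: right_ideal_def)
    ultimately show "c \<odot>\<^bsub>aug K H\<^esub> x \<in> I" by (simp add: aug_def)
  qed (auto simp: aug_def)
qed

section \<open>Descent of the connection form to the quotient\<close>

theorem proposition3p11:
  fixes K :: "('k, 'c) ring_scheme"
    and H :: "('k, 'h) hopf"
    and A :: "('k, 'h, 'a) comod_alg"
    and I :: "'h set"
    and N :: "('k, 'a, 'a) tens set"
    and l \<omega> :: "'h \<Rightarrow> ('k, 'a, 'a) tens"
  assumes "field K"
    and "hopf_algebra K H"
    and "bij_betw (antipode H) (carrier H) (carrier H)"
    and "principal_comodule_algebra K H A"
    and "right_ideal I H" and "I \<subseteq> carrier (aug K H)"
    and "covariant_calculus K H A N"
    and "sigma_generated_via K H A I N l \<omega>"
  shows "\<exists>\<omega>' \<in> linear_maps K (quot_module (aug K H) I) (quot_module (univ_calc K A) N).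
    \<forall>x\<in>carrier (aug K H). \<omega>' (I +>\<^bsub>aug K H\<^esub> x) = N +>\<^bsub>univ_calc K A\<^esub> \<omega> x"
proof -
  have A: "assoc_algebra K A"
    using assms by (simp add: principal_comodule_algebra_def comodule_algebra_def)
  then interpret AM: module K A by (simp add: assoc_algebra_def)
  let ?T = "tensor K A A" and ?U = "univ_calc K A" and ?E = "aug K H"
  interpret T: module K ?T by (intro tensor_is_module AM.module_axioms)
  have U: "carrier ?U \<subseteq> carrier ?T" by (auto simp: univ_calc_def a_kernel_def')
  have "submodule N K ?U" using assms by (simp add: covariant_calculus_def subbimodule_def)
  then have N: "submodule N K ?T"
    unfolding univ_calc_def by (rule T.submodule_of_restrict) (auto simp: a_kernel_def')
  have \<omega>: "\<omega> \<in> linear_maps K ?E ?U"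
    using assms by (simp add: sigma_generated_via_def associated_form_def connection_form_def)
  \<comment> \<open>The descent is carried out with target \<open>?T\<close>, whose module structure
    is at hand, and the result is transferred to \<open>?U\<close> afterwards.\<close>
  then have \<omega>T: "\<omega> \<in> linear_maps K ?E ?T"
    unfolding linear_maps_def using U by (simp add: univ_calc_def Pi_iff subset_iff)
  obtain g where g: "g \<in> linear_maps K (quot_module ?E I) (quot_module ?T N)"
    and g_eq: "\<forall>x\<in>carrier ?E. g (I +>\<^bsub>?E\<^esub> x) = N +>\<^bsub>?T\<^esub> \<omega> x"
    using module.linear_map_descends[OF aug_is_module[OF assms(2)] T.module_axioms
        right_ideal_submodule_aug[OF assms(2,5,6)] N \<omega>T
        sigma_generated_form_maps_ideal[OF A assms(6,8)]]
    by (elim bexE)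
  \<comment> \<open>\<open>?U\<close> and \<open>?T\<close> differ only in their carriers, while
    cosets and the operations of the quotients are formed from addition and scalar multiplication
    alone.\<close>
  have coset: "a_r_coset ?U = a_r_coset ?T" and add: "set_add ?U = set_add ?T"
    by (simp_all add: fun_eq_iff a_r_coset_def' set_add_def' univ_calc_def)
  have smult: "smult ?U = smult ?T" by (simp add: univ_calc_def)
  have ops: "add (quot_module ?U N) = add (quot_module ?T N)"
      "smult (quot_module ?U N) = smult (quot_module ?T N)"
    by (simp_all add: quot_module_def coset add smult)
  \<comment> \<open>The values of \<open>g\<close> have representatives \<open>\<omega> x\<close> in
    \<open>?U\<close>, so they lie in the smaller quotient.\<close>
  have "g X \<in> carrier (quot_module ?U N)" if "X \<in> carrier (quot_module ?E I)" for X
    using that g_eq \<omega> by (auto simp: carrier_quot_module coset linear_maps_def)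
  then have "g \<in> linear_maps K (quot_module ?E I) (quot_module ?U N)"
    using g by (simp add: linear_maps_def ops)
  then show ?thesis using g_eq by (auto simp: coset)
qed

end
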